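(* Let $\pi=x\,\partial_y\wedge\partial_z+y\,\partial_z\wedge\partial_x-z\,\partial_x\wedge\partial_y$ on $\mathfrak{sl}_2^*(\mathbb{R})\cong\mathbb{R}^3$ and $f=x^2+y^2-z^2$. The algebra of Casimir functions is isomorphic to the algebra of smooth functions on the regular part of the leaf-space, $C^\infty(\mathcal{Y}^{\mathrm{reg}})\simeq\mathrm{Cas}(\mathfrak{sl}_2^*(\mathbb{R}))$, and the isomorphism is given by $h=(h_1,h_2)\mapsto\widetilde{h}$, where $$\widetilde{h}(x,y,z)=\begin{cases}h_1(f(x,y,z)),& z\geq 0\\ h_2(f(x,y,z)),& z<0.\end{cases}$$
   Context: $\mathrm{Cas}(\mathfrak{sl}_2^*(\mathbb{R}))$ is the algebra of Casimir functions of $\pi$: smooth functions $g$ on $\mathbb{R}^3$ with $[\pi,g]=0$, equivalently constant along the symplectic leaves. The symplectic leaves of $\pi$ are: $S_\lambda=f^{-1}(\lambda)$ for $\lambda>0$; $S_\lambda^\pm=f^{-1}(\lambda)\cap\{\pm z>0\}$ for $\lambda\le 0$; and $S_0=\{0\}$. The leaf-space $\mathcal{Y}$ carries the quotient topology, and $\mathcal{Y}^{\mathrm{reg}}=\mathcal{Y}\setminus\{S_0\}$ is a smooth non-Hausdorff 1-manifold (its smooth structure is such that the quotient map is a submersion), with the two charts $\varphi^\pm$ on $U^\pm=\{S^\pm_\lambda\mid\lambda\le0\}\cup\{S_\lambda\mid\lambda>0\}$ given by $S^\pm_\lambda\mapsto\lambda$, $S_\lambda\mapsto\lambda$. Thus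 $\mathcal{Y}^{\mathrm{reg}}\simeq\mathbb{R}\sqcup_{(0,\infty)}\mathbb{R}$ (first copy corresponding to $U^+$, second to $U^-$), and $$C^\infty(\mathcal{Y}^{\mathrm{reg}})=\{(h_1,h_2)\in C^\infty(\mathbb{R})\times C^\infty(\mathbb{R})\mid h_1|_{(0,\infty)}=h_2|_{(0,\infty)}\}.$$ *)

theory Defs
  imports "HOL-Analysis.Analysis" "HOL-Algebra.Module" "HOL-Algebra.QuotRing"
begin

section \<open>Smooth functions\<close>

text \<open>
  Meant for finite-dimensional domains, where \<open>C\<^sup>k\<close> amounts to all directional derivatives
  being of class \<open>C\<^bsup>k-1\<^esup>\<close>.
\<close>

fun Ck :: "nat \<Rightarrow> ('a::euclidean_space \<Rightarrow> 'b::real_normed_vector) \<Rightarrow> bool" where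
  "Ck 0 g \<longleftrightarrow> continuous_on UNIV g"
| "Ck (Suc k) g \<longleftrightarrow>
     (\<forall>x. g differentiable (at x)) \<and> (\<forall>v. Ck k (\<lambda>x. frechet_derivative g (at x) v))"

definition smooth :: "('a::euclidean_space \<Rightarrow> 'b::real_normed_vector) \<Rightarrow> bool" where
  "smooth g \<longleftrightarrow> (\<forall>k. Ck k g)"


section \<open>Bivector fields, Casimir functions and symplectic leaves\<close>

text \<open>
  A bivector field on \<open>\<real>\<^sup>n\<close> is given by its matrix of components;
  \<open>v \<and> w\<close> has components \<open>v\<^sub>i w\<^sub>j - v\<^sub>j w\<^sub>i\<close>.
\<close>

definition wedge :: "real^'n \<Rightarrow> real^'n \<Rightarrow> real^'n^'n" where
  "wedge v w = (\<chi> i j. v $ i * w $ j - v $ j * w $ i)"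

definition gradient :: "(real^'n \<Rightarrow> real) \<Rightarrow> real^'n \<Rightarrow> real^'n" where
  "gradient g p = (\<chi> i. frechet_derivative g (at p) (axis i 1))"

text \<open>
  The Schouten bracket \<open>[P, g]\<close> of a bivector field with a function is the vector field determined
  by \<open>[X \<and> Y, g] = Y(g) X - X(g) Y\<close>.  The opposite sign convention is also in use; it affects
  neither the Casimir functions nor the leaves.  Up to sign, \<open>[P, g]\<close> is the Hamiltonian vector
  field of \<open>g\<close>.
\<close>

definition schouten :: "(real^'n \<Rightarrow> real^'n^'n) \<Rightarrow> (real^'n \<Rightarrow> real) \<Rightarrow> real^'n \<Rightarrow> real^'n" where
  "schouten P g p = P p *v gradient g p"

definition casimirs :: "(real^'n \<Rightarrow> real^'n^'n) \<Rightarrow> (real^'n \<Rightarrow> real) set" where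
  "casimirs P = {g. smooth g \<and> (\<forall>p. schouten P g p = 0)}"

text \<open>
  Symplectic leaves are the classes of points that can be joined by finitely many pieces of integral
  curves of Hamiltonian vector fields.  As \<open>schouten P\<close> is linear in the function, every such
  piece can be reparametrised to \<open>[0,1]\<close> and traversed backwards, so \<open>leaf_rel P\<close> is an
  equivalence relation.
\<close>

definition ham_step :: "(real^'n \<Rightarrow> real^'n^'n) \<Rightarrow> (real^'n) rel" where
  "ham_step P = {(p, q). \<exists>H \<gamma>. smooth H \<and> \<gamma> 0 = p \<and> \<gamma> 1 = q \<and>
     (\<forall>t\<in>{0..1}. (\<gamma> has_vector_derivative schouten P H (\<gamma> t)) (at t within {0..1}))}"

definition leaf_rel :: "(real^'n \<Rightarrow> real^'n^'n) \<Rightarrow> (real^'n) rel" where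
  "leaf_rel P = (ham_step P)\<^sup>*"

definition leaf_space :: "(real^'n \<Rightarrow> real^'n^'n) \<Rightarrow> (real^'n) set set" where
  "leaf_space P = UNIV // leaf_rel P"


section \<open>The Lie--Poisson structure of \<open>sl\<^sub>2\<^sup>*(\<real>)\<close>\<close>

definition pi_sl2 :: "real^3 \<Rightarrow> real^3^3" where
  "pi_sl2 p = (p$1) *\<^sub>R wedge (axis 2 1) (axis 3 1)
            + (p$2) *\<^sub>R wedge (axis 3 1) (axis 1 1)
            - (p$3) *\<^sub>R wedge (axis 1 1) (axis 2 1)"

definition f_sl2 :: "real^3 \<Rightarrow> real" where
  "f_sl2 p = (p$1)\<^sup>2 + (p$2)\<^sup>2 - (p$3)\<^sup>2"

definition leaves_reg :: "(real^3) set set" where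
  "leaves_reg = leaf_space pi_sl2 - {{0}}"

definition S_level :: "real \<Rightarrow> (real^3) set" where
  "S_level c = {p. f_sl2 p = c}"

definition S_plus :: "real \<Rightarrow> (real^3) set" where
  "S_plus c = {p. f_sl2 p = c \<and> p$3 > 0}"

definition S_minus :: "real \<Rightarrow> (real^3) set" where
  "S_minus c = {p. f_sl2 p = c \<and> p$3 < 0}"

definition U_plus :: "(real^3) set set" where
  "U_plus = {S_plus c | c. c \<le> 0} \<union> {S_level c | c. c > 0}"

definition U_minus :: "(real^3) set set" where
  "U_minus = {S_minus c | c. c \<le> 0} \<union> {S_level c | c. c > 0}"

text \<open>Both charts send a leaf to the value of \<open>f\<close> on it.\<close>

definition leaf_value :: "(real^3) set \<Rightarrow> real" where
  "leaf_value L = (THE c. f_sl2 ` L = {c})"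

definition chart_plus :: "(real^3) set \<Rightarrow> real" where
  "chart_plus = restrict leaf_value U_plus"

definition chart_minus :: "(real^3) set \<Rightarrow> real" where
  "chart_minus = restrict leaf_value U_minus"

text \<open>
  The two charts form an atlas of the regular leaf space, each with image \<open>\<real>\<close>.
  The following maps a function to its representatives in these charts.
\<close>

definition chart_reps :: "((real^3) set \<Rightarrow> real) \<Rightarrow> (real \<Rightarrow> real) \<times> (real \<Rightarrow> real)" where
  "chart_reps F = (F \<circ> inv_into U_plus chart_plus, F \<circ> inv_into U_minus chart_minus)"

definition smooth_on_leaves_reg :: "((real^3) set \<Rightarrow> real) set" where
  "smooth_on_leaves_reg =
     {F \<in> extensional leaves_reg. smooth (fst (chart_reps F)) \<and> smooth (snd (chart_reps F))}"

definition smooth_pairs :: "((real \<Rightarrow> real) \<times> (real \<Rightarrow> real)) set" where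
  "smooth_pairs = {(h1, h2). smooth h1 \<and> smooth h2 \<and> (\<forall>t\<in>{0<..}. h1 t = h2 t)}"

definition tilde :: "(real \<Rightarrow> real) \<times> (real \<Rightarrow> real) \<Rightarrow> real^3 \<Rightarrow> real" where
  "tilde h p = (if p$3 \<ge> 0 then fst h (f_sl2 p) else snd h (f_sl2 p))"


section \<open>Real algebras\<close>

definition real_ring :: "real ring" where
  "real_ring = \<lparr>carrier = UNIV, mult = (*), one = 1, zero = 0, add = (+)\<rparr>"

definition algebra_iso ::
    "('r, 'm) ring_scheme \<Rightarrow> ('r, 'a, 'n) module_scheme \<Rightarrow> ('r, 'b, 'k) module_scheme \<Rightarrow> ('a \<Rightarrow> 'b) set" where
  "algebra_iso R A B = {\<phi> \<in> ring_iso A B.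
     \<forall>c\<in>carrier R. \<forall>a\<in>carrier A. \<phi> (c \<odot>\<^bsub>A\<^esub> a) = c \<odot>\<^bsub>B\<^esub> \<phi> a}"

text \<open>Pointwise operations on a set \<open>A\<close> of real functions with domain \<open>X\<close>.\<close>

definition fun_algebra :: "'a set \<Rightarrow> ('a \<Rightarrow> real) set \<Rightarrow> (real, 'a \<Rightarrow> real) module" where
  "fun_algebra X A = \<lparr>carrier = A,
     mult = (\<lambda>g h. \<lambda>x\<in>X. g x * h x), one = (\<lambda>x\<in>X. 1),
     zero = (\<lambda>x\<in>X. 0), add = (\<lambda>g h. \<lambda>x\<in>X. g x + h x),
     smult = (\<lambda>c g. \<lambda>x\<in>X. c * g x)\<rparr>"

definition cas_algebra :: "(real, real^3 \<Rightarrow> real) module" where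
  "cas_algebra = fun_algebra UNIV (casimirs pi_sl2)"

definition leaf_algebra :: "(real, (real^3) set \<Rightarrow> real) module" where
  "leaf_algebra = fun_algebra leaves_reg smooth_on_leaves_reg"

definition pair_algebra :: "(real, (real \<Rightarrow> real) \<times> (real \<Rightarrow> real)) module" where
  "pair_algebra = \<lparr>carrier = smooth_pairs,
     mult = (\<lambda>(g1, g2) (h1, h2). (\<lambda>t. g1 t * h1 t, \<lambda>t. g2 t * h2 t)),
     one = (\<lambda>t. 1, \<lambda>t. 1),
     zero = (\<lambda>t. 0, \<lambda>t. 0),
     add = (\<lambda>(g1, g2) (h1, h2). (\<lambda>t. g1 t + h1 t, \<lambda>t. g2 t + h2 t)),
     smult = (\<lambda>c (h1, h2). (\<lambda>t. c * h1 t, \<lambda>t. c * h2 t))\<rparr>"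

end

theory Submission
  imports Defs
begin

text \<open>
  The leaves are described by two invariants: the value of \<open>f\<close> and, where \<open>f \<le> 0\<close>, the sign of \<open>z\<close>
  (\<open>leaf_rel_pi_sl2_iff\<close>).  Hamiltonian flows preserve \<open>f\<close>, as they do every Casimir function.  On
  \<open>f \<le> 0\<close> the coordinate \<open>z\<close> vanishes only at the origin, and a curve cannot reach or leave the
  origin because Hamiltonian vector fields of a linear bivector field grow at most linearly there;
  so the sign of \<open>z\<close> is preserved too.  Conversely, rotations about the \<open>z\<close>-axis and hyperbolic
  rotations of the \<open>(y, z)\<close>-plane, which are the flows of linear Hamiltonians, take every point other
  than the origin to one of the two affine lines \<open>section_plus\<close> and \<open>section_minus\<close>, on which \<open>f\<close>
  is the affine parameter.  Thus the regular leaf space consists of two copies of \<open>\<real>\<close> glued along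
  the positive half-line, and its smooth functions are the smooth pairs (\<open>bij_chart_reps\<close>).

  For a smooth pair \<open>h = (h1, h2)\<close> the function \<open>tilde h\<close> is smooth, even across the plane \<open>z = 0\<close>
  and at the origin: on that plane \<open>f \<ge> 0\<close>, and there \<open>h1\<close> and \<open>h2\<close> agree together with all their
  derivatives.  So \<open>tilde h\<close> is differentiable with \<open>d (tilde h) = tilde (h1', h2') df\<close>
  (\<open>has_derivative_tilde\<close>), and iteration gives smoothness.  The formula also shows
  that the gradient of \<open>tilde h\<close> is proportional to that of \<open>f\<close>, hence \<open>tilde h\<close> is a Casimir
  function.

  Conversely, a Casimir function \<open>g\<close> is constant on leaves, so \<open>g = tilde h\<close> where \<open>h1\<close> and \<open>h2\<close>
  are the restrictions of \<open>g\<close> to the two lines (\<open>casimir_eq_tilde\<close>); these are smooth because the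
  lines are affine.  The value at the origin is forced by continuity.  All operations are pointwise,
  so both bijections are isomorphisms of algebras.
\<close>

section \<open>Smooth functions\<close>

text \<open>
  Gives access to \<open>Ck\<close> from a derivative found by the usual rules, without mention of
  \<open>frechet_derivative\<close>.
\<close>

lemma Ck_SucI:
  assumes "\<And>x. (g has_derivative D x) (at x)" and "\<And>v. Ck k (\<lambda>x. D x v)"
  shows "Ck (Suc k) g"
proof -
  have "frechet_derivative g (at x) = D x" for x
    using frechet_derivative_at[OF assms(1)] by metis
  moreover have "g differentiable (at x)" for x
    using assms(1) by (rule differentiableI)
  ultimately show ?thesis using assms(2) by simp
qed

lemma Ck_Suc_imp_Ck: "Ck (Suc k) g \<Longrightarrow> Ck k g"
proof (induction k arbitrary: g)
  case 0
  then show ?case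
    by (simp add: continuous_at_imp_continuous_on differentiable_imp_continuous_within)
next
  case (Suc k)
  then show ?case by (metis Ck.simps(2))
qed

lemma Ck_const: "Ck k (\<lambda>x. c)"
proof (induction k arbitrary: c)
  case (Suc k)
  show ?case by (rule Ck_SucI[where D = "\<lambda>x v. 0"]) (auto intro: Suc)
qed simp

lemma Ck_bounded_linear:
  assumes "bounded_linear g"
  shows "Ck k g"
proof (cases k)
  case (Suc k')
  show ?thesis unfolding Suc
    by (rule Ck_SucI[where D = "\<lambda>x. g"])
       (auto intro: Ck_const bounded_linear_imp_has_derivative assms)
qed (simp add: assms linear_continuous_on)

lemma Ck_add:
  assumes "Ck k g" and "Ck k h"
  shows "Ck k (\<lambda>x. g x + h x)"
  using assms
proof (induction k arbitrary: g h)
  case (Suc k)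
  show ?case
  proof (rule Ck_SucI)
    show "((\<lambda>x. g x + h x) has_derivative
        (\<lambda>v. frechet_derivative g (at x) v + frechet_derivative h (at x) v)) (at x)" for x
      using Suc.prems by (auto intro!: has_derivative_add simp: frechet_derivative_works[symmetric])
  qed (use Suc in auto)
qed (simp add: continuous_on_add)

lemma Ck_mult:
  fixes g h :: "'a::euclidean_space \<Rightarrow> real"
  assumes "Ck k g" and "Ck k h"
  shows "Ck k (\<lambda>x. g x * h x)"
  using assms
proof (induction k arbitrary: g h)
  case (Suc k)
  show ?case
  proof (rule Ck_SucI)
    show "((\<lambda>x. g x * h x) has_derivative
        (\<lambda>v. g x * frechet_derivative h (at x) v + frechet_derivative g (at x) v * h x)) (at x)" for x
      using Suc.prems by (auto intro!: has_derivative_mult simp: frechet_derivative_works[symmetric])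
    show "Ck k (\<lambda>x. g x * frechet_derivative h (at x) v + frechet_derivative g (at x) v * h x)" for v
      using Suc.prems Suc.prems[THEN Ck_Suc_imp_Ck] by (intro Ck_add Suc.IH) simp_all
  qed
qed (simp add: continuous_on_mult)

lemma Ck_compose_affine:
  assumes "bounded_linear A" and "Ck k g"
  shows "Ck k (\<lambda>x. g (A x + b))"
  using assms(2)
proof (induction k arbitrary: g)
  case 0
  then show ?case
    by (simp, intro continuous_on_compose2[of UNIV g UNIV "\<lambda>x. A x + b"])
       (auto intro!: continuous_on_add linear_continuous_on[OF assms(1)])
next
  case (Suc k)
  show ?case
  proof (rule Ck_SucI)
    have A: "((\<lambda>x. A x + b) has_derivative A) (at x)" for x
      using bounded_linear_imp_has_derivative[OF assms(1)]
      by (auto intro!: derivative_eq_intros)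
    show "((\<lambda>x. g (A x + b)) has_derivative
        (\<lambda>v. frechet_derivative g (at (A x + b)) (A v))) (at x)" for x
      using diff_chain_at[OF A, of g "frechet_derivative g (at (A x + b))" x] Suc.prems
      by (simp add: o_def frechet_derivative_works[symmetric])
    show "Ck k (\<lambda>x. frechet_derivative g (at (A x + b)) (A v))" for v
      using Suc.IH[of "\<lambda>y. frechet_derivative g (at y) (A v)"] Suc.prems by simp
  qed
qed

lemma smooth_const: "smooth (\<lambda>x. c)"
  by (simp add: smooth_def Ck_const)

lemma smooth_bounded_linear: "bounded_linear g \<Longrightarrow> smooth g"
  by (simp add: smooth_def Ck_bounded_linear)

lemma smooth_add: "smooth g \<Longrightarrow> smooth h \<Longrightarrow> smooth (\<lambda>x. g x + h x)"
  by (simp add: smooth_def Ck_add)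

lemma smooth_mult:
  fixes g h :: "'a::euclidean_space \<Rightarrow> real"
  shows "smooth g \<Longrightarrow> smooth h \<Longrightarrow> smooth (\<lambda>x. g x * h x)"
  by (simp add: smooth_def Ck_mult)

lemma smooth_compose_affine:
  "bounded_linear A \<Longrightarrow> smooth g \<Longrightarrow> smooth (\<lambda>x. g (A x + b))"
  by (simp add: smooth_def Ck_compose_affine)

lemma smooth_differentiable: "smooth g \<Longrightarrow> g differentiable (at x)"
  unfolding smooth_def by (metis Ck.simps(2))

lemma smooth_continuous: "smooth g \<Longrightarrow> continuous_on S g"
  unfolding smooth_def by (metis Ck.simps(1) continuous_on_subset subset_UNIV)

lemma smooth_frechet: "smooth g \<Longrightarrow> smooth (\<lambda>x. frechet_derivative g (at x) v)"
  unfolding smooth_def by (metis Ck.simps(2))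

lemma smooth_has_deriv:
  fixes h :: "real \<Rightarrow> real"
  assumes "smooth h"
  shows "(h has_real_derivative deriv h t) (at t)"
  by (simp add: smooth_differentiable[OF assms] DERIV_deriv_iff_real_differentiable)

lemma smooth_deriv:
  fixes h :: "real \<Rightarrow> real"
  assumes "smooth h"
  shows "smooth (deriv h)"
proof -
  have "deriv h = (\<lambda>t. frechet_derivative h (at t) 1)"
  proof
    fix t
    have "(h has_derivative (*) (deriv h t)) (at t)"
      using smooth_has_deriv[OF assms] by (simp add: has_field_derivative_def)
    then show "deriv h t = frechet_derivative h (at t) 1"
      by (simp flip: frechet_derivative_at)
  qed
  then show ?thesis using smooth_frechet[OF assms] by simp
qed

section \<open>Gluing two functions of \<open>f\<close> along the plane \<open>z = 0\<close>\<close>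

lemma inner_vector_3: "vector [a, b, c] \<bullet> (v :: real^3) = a * v$1 + b * v$2 + c * v$3"
  by (simp add: inner_vec_def sum_3)

lemma has_derivative_f_sl2:
  "(f_sl2 has_derivative (\<lambda>v. vector [2 * p$1, 2 * p$2, - 2 * p$3] \<bullet> v)) (at p)"
  unfolding f_sl2_def
  by (auto intro!: derivative_eq_intros bounded_linear_imp_has_derivative bounded_linear_vec_nth ext
      simp: inner_vector_3)

text \<open>
  The error estimate in the definition of the derivative holds for both functions at once near
  \<open>p\<close>, so it survives any choice between them, however irregular.
\<close>

lemma has_derivative_glue:
  assumes 1: "(g1 has_derivative D) (at p)" and 2: "(g2 has_derivative D) (at p)"
    and eq: "g1 p = g2 p"
  shows "((\<lambda>x. if Q x then g1 x else g2 x) has_derivative D) (at p)"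
  unfolding has_derivative_at_alt
proof (intro conjI allI impI)
  show "bounded_linear D" using 1 by (rule has_derivative_bounded_linear)
next
  fix e :: real assume "e > 0"
  obtain d1 where "d1 > 0" "\<And>y. norm (y - p) < d1 \<Longrightarrow> norm (g1 y - g1 p - D (y - p)) \<le> e * norm (y - p)"
    using 1 \<open>e > 0\<close> unfolding has_derivative_at_alt by blast
  moreover
  obtain d2 where "d2 > 0" "\<And>y. norm (y - p) < d2 \<Longrightarrow> norm (g2 y - g2 p - D (y - p)) \<le> e * norm (y - p)"
    using 2 \<open>e > 0\<close> unfolding has_derivative_at_alt by blast
  ultimately show "\<exists>d>0. \<forall>y. norm (y - p) < d \<longrightarrow>
      norm ((if Q y then g1 y else g2 y) - (if Q p then g1 p else g2 p) - D (y - p)) \<le> e * norm (y - p)"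
    using eq by (intro exI[of _ "min d1 d2"]) auto
qed

text \<open>
  By continuity the agreement on the open half-line extends to its end point.  Together with
  \<open>smooth_pairs_deriv\<close> this says that the two functions have the same Taylor series at \<open>0\<close>.
\<close>

lemma smooth_pairs_agree:
  assumes "(h1, h2) \<in> smooth_pairs" and "t \<ge> 0"
  shows "h1 t = h2 t"
proof -
  have "h1 t - h2 t = 0"
  proof (rule continuous_constant_on_closure[where S = "{0<..}" and f = "\<lambda>s. h1 s - h2 s"])
    have "continuous_on UNIV h1" "continuous_on UNIV h2"
      using assms(1) by (auto simp: smooth_pairs_def intro: smooth_continuous)
    then show "continuous_on (closure {0<..}) (\<lambda>s. h1 s - h2 s)"
      by (metis continuous_on_diff continuous_on_subset subset_UNIV)
  qed (use assms in \<open>auto simp: smooth_pairs_def\<close>)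
  then show ?thesis by simp
qed

lemma smooth_pairs_deriv:
  assumes "(h1, h2) \<in> smooth_pairs"
  shows "(deriv h1, deriv h2) \<in> smooth_pairs"
proof -
  have "deriv h1 t = deriv h2 t" if "t > 0" for t
  proof (rule deriv_cong_ev)
    show "eventually (\<lambda>s. h1 s = h2 s) (nhds t)"
      using eventually_nhds_in_open[of "{0<..}" t] that assms
      by (auto simp: smooth_pairs_def elim!: eventually_mono)
  qed simp
  then show ?thesis using assms by (auto simp: smooth_pairs_def smooth_deriv)
qed

text \<open>
  On the plane \<open>z = 0\<close>, where the case distinction jumps, \<open>f = x\<^sup>2 + y\<^sup>2\<close> is non-negative, so \<open>h1\<close>
  and \<open>h2\<close> have the same value and the same derivative there.  The partial derivatives are again
  of the form \<open>tilde\<close>, up to a linear factor, which makes an induction on the order of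
  differentiability possible.
\<close>

lemma has_derivative_tilde:
  assumes h: "(h1, h2) \<in> smooth_pairs"
  shows "(tilde (h1, h2) has_derivative
    (\<lambda>v. tilde (deriv h1, deriv h2) p * (vector [2 * p$1, 2 * p$2, - 2 * p$3] \<bullet> v))) (at p)"
proof -
  define df where "df v = vector [2 * p$1, 2 * p$2, - 2 * p$3] \<bullet> v" for v :: "real^3"
  have f: "(f_sl2 has_derivative df) (at p)"
    unfolding df_def by (rule has_derivative_f_sl2)
  have chain: "((\<lambda>q. k (f_sl2 q)) has_derivative (\<lambda>v. deriv k (f_sl2 p) * df v)) (at p)"
    if "smooth k" for k
    using diff_chain_at[OF f, of k "(*) (deriv k (f_sl2 p))"] smooth_has_deriv[OF that]
    by (simp add: o_def has_field_derivative_def)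
  have s: "smooth h1" "smooth h2" using h by (auto simp: smooth_pairs_def)
  consider "p$3 > 0" | "p$3 < 0" | "p$3 = 0" by linarith
  then have "(tilde (h1, h2) has_derivative (\<lambda>v. tilde (deriv h1, deriv h2) p * df v)) (at p)"
  proof cases
    case 1
    have "open {q :: real^3. q$3 > 0}" by (intro open_halfspace_component_gt_cart)
    from has_derivative_transform_within_open[OF chain[OF s(1)] this, of "tilde (h1, h2)"] 1
    show ?thesis by (simp add: tilde_def)
  next
    case 2
    have "open {q :: real^3. q$3 < 0}" by (intro open_halfspace_component_lt_cart)
    from has_derivative_transform_within_open[OF chain[OF s(2)] this, of "tilde (h1, h2)"] 2
    show ?thesis by (simp add: tilde_def)
  next
    case 3
    then have "f_sl2 p \<ge> 0" by (simp add: f_sl2_def)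
    then have "h1 (f_sl2 p) = h2 (f_sl2 p)" "deriv h1 (f_sl2 p) = deriv h2 (f_sl2 p)"
      using smooth_pairs_agree h smooth_pairs_deriv by blast+
    with has_derivative_glue[of "\<lambda>q. h1 (f_sl2 q)" _ p "\<lambda>q. h2 (f_sl2 q)" "\<lambda>q. q$3 \<ge> 0"]
      chain[OF s(1)] chain[OF s(2)] 3
    show ?thesis by (simp add: tilde_def[abs_def] cong: if_cong)
  qed
  then show ?thesis by (simp add: df_def)
qed

lemma Ck_tilde:
  assumes "(h1, h2) \<in> smooth_pairs"
  shows "Ck k (tilde (h1, h2))"
  using assms
proof (induction k arbitrary: h1 h2)
  case 0
  then show ?case
    by (metis Ck.simps(1) continuous_at_imp_continuous_on has_derivative_continuous has_derivative_tilde)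
next
  case (Suc k)
  show ?case
  proof (rule Ck_SucI[OF has_derivative_tilde[OF Suc.prems]])
    show "Ck k (\<lambda>p. tilde (deriv h1, deriv h2) p * (vector [2 * p$1, 2 * p$2, - 2 * p$3] \<bullet> v))" for v :: "real^3"
    proof (intro Ck_mult Suc.IH smooth_pairs_deriv Suc.prems Ck_bounded_linear)
      show "bounded_linear (\<lambda>p :: real^3. vector [2 * p$1, 2 * p$2, - 2 * p$3] \<bullet> v)"
        by (simp add: inner_vector_3 bounded_linear_add bounded_linear_sub bounded_linear_mult_const bounded_linear_const_mult bounded_linear_vec_nth algebra_simps)
    qed
  qed
qed

section \<open>Hamiltonian flows and leaves of a bivector field\<close>

text \<open>
  The components of \<open>gradient\<close> are the partial derivatives, so this expresses the linearity of the
  total derivative in terms of the standard basis.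
\<close>

lemma has_derivative_gradient:
  assumes "g differentiable (at p)"
  shows "(g has_derivative (\<lambda>v. gradient g p \<bullet> v)) (at p)"
proof -
  have D: "(g has_derivative frechet_derivative g (at p)) (at p)"
    using assms by (simp add: frechet_derivative_works)
  then have lin: "linear (frechet_derivative g (at p))"
    by (rule has_derivative_linear)
  have "frechet_derivative g (at p) v = gradient g p \<bullet> v" for v
  proof -
    have "frechet_derivative g (at p) v = frechet_derivative g (at p) (\<Sum>i\<in>UNIV. v$i *\<^sub>R axis i 1)"
      by (simp add: basis_expansion flip: scalar_mult_eq_scaleR)
    also have "\<dots> = gradient g p \<bullet> v"
      by (simp add: linear_sum[OF lin] linear_cmul[OF lin] gradient_def inner_vec_def mult.commute)
    finally show ?thesis .
  qed
  then have "frechet_derivative g (at p) = (\<lambda>v. gradient g p \<bullet> v)" by blast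
  then show ?thesis using D by simp
qed

lemma gradient_eqI:
  assumes "(g has_derivative (\<lambda>v. w \<bullet> v)) (at p)"
  shows "gradient g p = w"
  by (simp add: gradient_def vec_eq_iff inner_axis flip: frechet_derivative_at[OF assms])

lemma skew_matrix_inner:
  fixes A :: "real^'n^'n"
  assumes "transpose A = - A"
  shows "v \<bullet> (A *v w) = - ((A *v v) \<bullet> w)"
proof -
  have "v \<bullet> (A *v w) = (transpose A *v v) \<bullet> w"
    by (simp add: dot_lmul_matrix transpose_matrix_vector)
  then show ?thesis
    by (simp add: assms matrix_vector_mult_def inner_vec_def sum_negf)
qed

text \<open>
  Along the flow of \<open>H\<close> the derivative of \<open>g\<close> is \<open>grad g \<bullet> (P *v grad H) = - (P *v grad g) \<bullet> grad H\<close>,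
  by skew symmetry of \<open>P\<close>, and this vanishes when \<open>g\<close> is a Casimir function.
\<close>

lemma casimir_constant_along_flow:
  assumes skew: "\<And>p. transpose (P p) = - P p"
    and g: "\<And>p. g differentiable (at p)" "\<And>p. schouten P g p = 0"
    and \<gamma>: "\<And>t. t \<in> {0..1} \<Longrightarrow>
      (\<gamma> has_vector_derivative schouten P H (\<gamma> t)) (at t within {0..1})"
    and t: "t \<in> {0..1}"
  shows "g (\<gamma> t) = g (\<gamma> 0)"
proof -
  have "((\<lambda>s. g (\<gamma> s)) has_derivative (\<lambda>s. 0)) (at t within {0..1})" if "t \<in> {0..1}" for t
  proof -
    have "gradient g (\<gamma> t) \<bullet> schouten P H (\<gamma> t) = 0"
      using g(2)[of "\<gamma> t"] by (simp add: schouten_def skew_matrix_inner[OF skew])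
    then show ?thesis
      using diff_chain_within[OF \<gamma>[OF that, unfolded has_vector_derivative_def]
        has_derivative_at_withinI[OF has_derivative_gradient[OF g(1)]]]
      by (simp add: o_def)
  qed
  then have "\<exists>c. \<forall>t\<in>{0..1}. g (\<gamma> t) = c"
    by (intro has_derivative_zero_constant) auto
  then show ?thesis using t by force
qed

lemma casimir_constant_on_leaves:
  assumes skew: "\<And>p. transpose (P p) = - P p"
    and g: "\<And>p. g differentiable (at p)" "\<And>p. schouten P g p = 0"
    and "(p, q) \<in> leaf_rel P"
  shows "g p = g q"
  using assms(4) unfolding leaf_rel_def
proof (induction rule: rtrancl_induct)
  case (step q r)
  then obtain H \<gamma> where "\<gamma> 0 = q" "\<gamma> 1 = r"
    "\<And>t. t \<in> {0..1} \<Longrightarrow> (\<gamma> has_vector_derivative schouten P H (\<gamma> t)) (at t within {0..1})"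
    unfolding ham_step_def by blast
  then have "g r = g q"
    using casimir_constant_along_flow[OF skew g, of \<gamma> H 1] by simp
  then show ?case using step by simp
qed simp

lemma gradient_uminus:
  assumes "H differentiable (at p)"
  shows "gradient (\<lambda>p. - H p) p = - gradient H p"
  using has_derivative_minus[OF has_derivative_gradient[OF assms]]
  by (intro gradient_eqI) simp

lemma smooth_uminus: "smooth H \<Longrightarrow> smooth (\<lambda>p. - H p :: real)"
  using smooth_mult[OF smooth_const[of "-1"], of H] by simp

text \<open>
  Reversing time turns an integral curve for \<open>H\<close> into one for \<open>- H\<close>.
\<close>

lemma sym_ham_step: "sym (ham_step P)"
proof (rule symI)
  fix p q assume "(p, q) \<in> ham_step P"
  then obtain H \<gamma> where H: "smooth H" and \<gamma>: "\<gamma> 0 = p" "\<gamma> 1 = q"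
    "\<And>t. t \<in> {0..1} \<Longrightarrow> (\<gamma> has_vector_derivative schouten P H (\<gamma> t)) (at t within {0..1})"
    unfolding ham_step_def by blast
  have "((\<lambda>t. \<gamma> (1 - t)) has_vector_derivative schouten P (\<lambda>p. - H p) (\<gamma> (1 - t)))
      (at t within {0..1})" if "t \<in> {0..1}" for t
  proof -
    have "((\<lambda>t. 1 - t) has_vector_derivative - 1) (at t within {0..1})"
      by (auto intro!: derivative_eq_intros)
    moreover have "(\<lambda>t. 1 - t) ` {0..1} = {0..1::real}"
      by (simp add: image_minus_const_atLeastAtMost')
    ultimately have "((\<lambda>t. \<gamma> (1 - t)) has_vector_derivative - schouten P H (\<gamma> (1 - t)))
        (at t within {0..1})"
      using vector_diff_chain_within[of "\<lambda>t. 1 - t" "- 1" t "{0..1}" \<gamma>] \<gamma>(3)[of "1 - t"] that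
      by (simp add: o_def)
    moreover have "schouten P (\<lambda>p. - H p) p = - schouten P H p" for p
      by (simp add: schouten_def gradient_uminus[OF smooth_differentiable[OF H]]
          matrix_vector_mult_def vec_eq_iff sum_negf)
    ultimately show ?thesis by simp
  qed
  then show "(q, p) \<in> ham_step P"
    unfolding ham_step_def using \<gamma>(1,2) smooth_uminus[OF H]
    by (auto intro!: exI[of _ "\<lambda>p. - H p"] exI[of _ "\<lambda>t. \<gamma> (1 - t)"])
qed

lemma equiv_leaf_rel: "equiv UNIV (leaf_rel P)"
  unfolding leaf_rel_def
  by (intro equivI) (auto intro: refl_rtrancl sym_rtrancl sym_ham_step trans_rtrancl)

text \<open>
  An argument of Gronwall type: \<open>exp (2 * C * t) * (\<gamma> t \<bullet> \<gamma> t)\<close> is non-decreasing and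
  \<open>exp (- 2 * C * t) * (\<gamma> t \<bullet> \<gamma> t)\<close> is non-increasing, so a zero propagates in both directions
  of time.
\<close>

lemma linear_growth_zero:
  fixes \<gamma> :: "real \<Rightarrow> 'a::real_inner"
  assumes "a \<le> b"
    and d: "\<And>t. t \<in> {a..b} \<Longrightarrow> (\<gamma> has_vector_derivative \<gamma>' t) (at t within {a..b})"
    and C: "\<And>t. t \<in> {a..b} \<Longrightarrow> \<bar>\<gamma> t \<bullet> \<gamma>' t\<bar> \<le> C * (\<gamma> t \<bullet> \<gamma> t)"
  shows "\<gamma> a = 0 \<longleftrightarrow> \<gamma> b = 0"
proof -
  define \<phi> where "\<phi> c t = exp (c * t) * (\<gamma> t \<bullet> \<gamma> t)" for c t
  have D: "(\<phi> c has_derivative (\<lambda>s. s * (exp (c * t) * (c * (\<gamma> t \<bullet> \<gamma> t) + 2 * (\<gamma> t \<bullet> \<gamma>' t)))))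
      (at t within {a..b})" if "t \<in> {a..b}" for c t
    unfolding \<phi>_def using d[OF that] unfolding has_vector_derivative_def
    by (auto intro!: derivative_eq_intros ext simp: algebra_simps inner_commute)
  have "\<exists>t\<in>{a..b}. \<phi> c b - \<phi> c a = (b - a) * (exp (c * t) * (c * (\<gamma> t \<bullet> \<gamma> t) + 2 * (\<gamma> t \<bullet> \<gamma>' t)))" for c
    using mvt_very_simple[OF assms(1), OF D[of _ c]] by auto
  then obtain \<tau> where \<tau>: "\<And>c. \<tau> c \<in> {a..b}"
    "\<And>c. \<phi> c b - \<phi> c a = (b - a) * (exp (c * \<tau> c) *
        (c * (\<gamma> (\<tau> c) \<bullet> \<gamma> (\<tau> c)) + 2 * (\<gamma> (\<tau> c) \<bullet> \<gamma>' (\<tau> c))))"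
    by metis
  have "\<phi> (2 * C) b - \<phi> (2 * C) a \<ge> 0"
    unfolding \<tau>(2) using C[OF \<tau>(1)[of "2 * C"]] assms(1) by (intro mult_nonneg_nonneg) auto
  moreover have "\<phi> (- 2 * C) b - \<phi> (- 2 * C) a \<le> 0"
    unfolding \<tau>(2) using C[OF \<tau>(1)[of "- 2 * C"]] assms(1)
    by (intro mult_nonneg_nonpos) auto
  ultimately have "\<gamma> b = 0 \<Longrightarrow> \<phi> (2 * C) a \<le> 0" "\<gamma> a = 0 \<Longrightarrow> \<phi> (- 2 * C) b \<le> 0"
    by (auto simp: \<phi>_def)
  moreover have "x \<bullet> x \<le> 0 \<longleftrightarrow> x = 0" for x :: 'a
    by (metis inner_ge_zero inner_eq_zero_iff order_antisym order_refl)
  ultimately show ?thesis by (auto simp: \<phi>_def mult_le_0_iff)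
qed

section \<open>The Hamiltonian flows of \<open>sl\<^sub>2\<^sup>*(\<real>)\<close>\<close>

lemma pi_sl2_mult_vec:
  "pi_sl2 p *v v = vector [- p$3 * v$2 - p$2 * v$3, p$3 * v$1 + p$1 * v$3, p$2 * v$1 - p$1 * v$2]"
  by (simp add: vec_eq_iff forall_3 pi_sl2_def wedge_def axis_def matrix_vector_mult_def sum_3)

lemma transpose_pi_sl2: "transpose (pi_sl2 p) = - pi_sl2 p"
  by (simp add: vec_eq_iff transpose_def pi_sl2_def wedge_def algebra_simps)

lemma schouten_f_sl2: "schouten pi_sl2 f_sl2 p = 0"
  using gradient_eqI[OF has_derivative_f_sl2, of p]
  by (simp add: schouten_def pi_sl2_mult_vec vec_eq_iff forall_3)

text \<open>
  The bivector field has linear coefficients, so it moves points at a speed at most proportional to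
  their distance from the origin.  This is the growth condition of \<open>linear_growth_zero\<close>.
\<close>

lemma inner_pi_sl2_bound:
  "\<bar>p \<bullet> (pi_sl2 p *v v)\<bar> \<le> 4 * norm v * (p \<bullet> p)"
proof -
  have a: "\<bar>p $ i\<bar> * \<bar>p $ j\<bar> * \<bar>v $ k\<bar> \<le> norm p * norm p * norm v" for i j k
    by (intro mult_mono component_le_norm_cart) auto
  have "p \<bullet> (pi_sl2 p *v v) = 2 * (p$2 * p$3 * v$1) - 2 * (p$1 * p$3 * v$2)"
    by (simp add: pi_sl2_mult_vec inner_vec_def sum_3 algebra_simps)
  also have "\<bar>\<dots>\<bar> \<le> 2 * (\<bar>p$2\<bar> * \<bar>p$3\<bar> * \<bar>v$1\<bar>) + 2 * (\<bar>p$1\<bar> * \<bar>p$3\<bar> * \<bar>v$2\<bar>)"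
    by (rule order_trans[OF abs_triangle_ineq4]) (simp add: abs_mult)
  also have "\<dots> \<le> 4 * norm v * (p \<bullet> p)"
    using a[of 2 3 1] a[of 1 3 2] by (simp add: algebra_simps power2_eq_square flip: power2_norm_eq_inner)
  finally show ?thesis .
qed

lemma continuous_gradient:
  assumes "smooth H"
  shows "continuous_on S (gradient H)"
  unfolding gradient_def
  by (intro continuous_on_vec_lambda smooth_continuous smooth_frechet assms)

text \<open>
  This separates the origin from the two open half-cones in \<open>f = 0\<close>, both of which have it in their
  closure.  The gradient of \<open>H\<close> is bounded along the compact curve, which gives the linear growth
  bound.
\<close>

lemma origin_isolated_from_flow:
  assumes H: "smooth H"
    and \<gamma>: "\<And>t. t \<in> {0..1} \<Longrightarrow>
      (\<gamma> has_vector_derivative schouten pi_sl2 H (\<gamma> t)) (at t within {0..1})"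
    and t: "t \<in> {0..1}"
  shows "\<gamma> 0 = 0 \<longleftrightarrow> \<gamma> t = 0"
proof -
  have "continuous_on {0..1} \<gamma>"
    using has_vector_derivative_continuous[OF \<gamma>] by (simp add: continuous_on_eq_continuous_within)
  then have "continuous_on {0..1} (\<lambda>t. gradient H (\<gamma> t))"
    by (intro continuous_on_compose2[OF continuous_gradient[OF H, of UNIV]]) auto
  then have "bounded ((\<lambda>t. gradient H (\<gamma> t)) ` {0..1})"
    by (intro compact_imp_bounded compact_continuous_image) auto
  then obtain C where C: "\<And>s. s \<in> {0..1} \<Longrightarrow> norm (gradient H (\<gamma> s)) \<le> C"
    unfolding bounded_iff by blast
  show ?thesis
  proof (rule linear_growth_zero[where \<gamma>' = "\<lambda>s. schouten pi_sl2 H (\<gamma> s)" and C = "4 * C"])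
    fix s assume s: "s \<in> {0..t}"
    then have s1: "s \<in> {0..1}" using t by auto
    show "(\<gamma> has_vector_derivative schouten pi_sl2 H (\<gamma> s)) (at s within {0..t})"
      using \<gamma>[OF s1] t by (auto intro: has_vector_derivative_within_subset)
    have "\<bar>\<gamma> s \<bullet> schouten pi_sl2 H (\<gamma> s)\<bar> \<le> 4 * norm (gradient H (\<gamma> s)) * (\<gamma> s \<bullet> \<gamma> s)"
      unfolding schouten_def by (rule inner_pi_sl2_bound)
    also have "\<dots> \<le> 4 * C * (\<gamma> s \<bullet> \<gamma> s)"
      using C[OF s1] by (intro mult_right_mono) auto
    finally show "\<bar>\<gamma> s \<bullet> schouten pi_sl2 H (\<gamma> s)\<bar> \<le> 4 * C * (\<gamma> s \<bullet> \<gamma> s)" .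
  qed (use t in auto)
qed

lemma f_sl2_le_0_imp_eq_0:
  assumes "f_sl2 p \<le> 0" and "p$3 = 0"
  shows "p = 0"
proof -
  have "(p$1)\<^sup>2 + (p$2)\<^sup>2 \<le> 0" using assms by (simp add: f_sl2_def)
  then have "p$1 = 0" "p$2 = 0" by (simp_all add: sum_power2_le_zero_iff)
  then show ?thesis using assms(2) by (simp add: vec_eq_iff forall_3)
qed

text \<open>
  Where \<open>f \<le> 0\<close>, the coordinate \<open>z\<close> vanishes only at the origin.  A Hamiltonian curve either stays
  at the origin or never meets it; in the latter case \<open>z\<close> cannot change sign, by the intermediate
  value theorem.
\<close>

lemma leaf_rel_sgn:
  assumes "(p, q) \<in> leaf_rel pi_sl2" and "f_sl2 p \<le> 0"
  shows "sgn (p$3) = sgn (q$3)"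
  using assms(1) unfolding leaf_rel_def
proof (induction rule: rtrancl_induct)
  case (step q r)
  then obtain H \<gamma> where H: "smooth H" and \<gamma>0: "\<gamma> 0 = q" and \<gamma>1: "\<gamma> 1 = r"
    and \<gamma>: "\<And>t. t \<in> {0..1} \<Longrightarrow>
      (\<gamma> has_vector_derivative schouten pi_sl2 H (\<gamma> t)) (at t within {0..1})"
    unfolding ham_step_def by blast
  have fd: "f_sl2 differentiable (at p)" for p
    using has_derivative_f_sl2 by (rule differentiableI)
  have "f_sl2 q = f_sl2 p"
    using casimir_constant_on_leaves[OF transpose_pi_sl2 fd schouten_f_sl2, of p q] step(1)
    by (simp add: leaf_rel_def)
  then have f: "f_sl2 (\<gamma> t) \<le> 0" if "t \<in> {0..1}" for t
    using casimir_constant_along_flow[OF transpose_pi_sl2 fd schouten_f_sl2 \<gamma> that] assms(2) \<gamma>0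
    by simp
  have origin: "q = 0 \<longleftrightarrow> \<gamma> t = 0" if "t \<in> {0..1}" for t
    using origin_isolated_from_flow[OF H \<gamma> that] \<gamma>0 by simp
  have "sgn (q$3) = sgn (r$3)"
  proof (cases "q = 0")
    case True
    then show ?thesis using origin[of 1] \<gamma>0 \<gamma>1 by simp
  next
    case False
    have nz: "\<gamma> t $ 3 \<noteq> 0" if "t \<in> {0..1}" for t
      using origin[OF that] f_sl2_le_0_imp_eq_0[OF f[OF that]] False \<gamma>0 by auto
    have "continuous_on {0..1} \<gamma>"
      using has_vector_derivative_continuous[OF \<gamma>] by (simp add: continuous_on_eq_continuous_within)
    then have "continuous_on {0..1} (\<lambda>t. \<gamma> t $ 3)" by (intro continuous_intros)
    then have "connected ((\<lambda>t. \<gamma> t $ 3) ` {0..1})"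
      by (intro connected_continuous_image) auto
    then have "is_interval ((\<lambda>t. \<gamma> t $ 3) ` {0..1})" by (simp add: is_interval_connected_1)
    moreover have "q$3 \<in> (\<lambda>t. \<gamma> t $ 3) ` {0..1}" "r$3 \<in> (\<lambda>t. \<gamma> t $ 3) ` {0..1}"
      using \<gamma>0 \<gamma>1 by force+
    moreover have "0 \<notin> (\<lambda>t. \<gamma> t $ 3) ` {0..1}" using nz by force
    ultimately have "\<not> (q$3 \<le> 0 \<and> 0 \<le> r$3)" "\<not> (r$3 \<le> 0 \<and> 0 \<le> q$3)"
      unfolding is_interval_1 by blast+
    then show ?thesis by (auto simp: sgn_if)
  qed
  then show ?case using step by simp
qed simp

text \<open>
  A linear Hamiltonian \<open>w \<bullet> p\<close> has constant gradient \<open>w\<close>.  For a Lie--Poisson structure the flows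
  of linear Hamiltonians generate the coadjoint action, whose orbits are the leaves.
\<close>

lemma ham_step_linear:
  fixes \<gamma> :: "real \<Rightarrow> real^'n"
  assumes "\<And>t. (\<gamma> has_vector_derivative P (\<gamma> t) *v w) (at t)"
  shows "(\<gamma> 0, \<gamma> 1) \<in> ham_step P"
proof -
  have lin: "bounded_linear (\<lambda>p. w \<bullet> p)" by (rule bounded_linear_inner_right)
  have "gradient (\<lambda>p. w \<bullet> p) p = w" for p
    by (rule gradient_eqI[OF bounded_linear_imp_has_derivative[OF lin]])
  then have "(\<gamma> has_vector_derivative schouten P (\<lambda>p. w \<bullet> p) (\<gamma> t)) (at t within {0..1})" for t
    unfolding schouten_def using has_vector_derivative_at_within[OF assms] by simp
  with smooth_bounded_linear[OF lin] show ?thesis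
    unfolding ham_step_def by blast
qed

lemma has_vector_derivative_componentwise_cart:
  fixes \<gamma> :: "real \<Rightarrow> real^'n"
  shows "(\<gamma> has_vector_derivative d) (at t within S) \<longleftrightarrow>
    (\<forall>i. ((\<lambda>s. \<gamma> s $ i) has_vector_derivative d $ i) (at t within S))"
  unfolding has_vector_derivative_def
  by (subst has_derivative_componentwise_within) (auto simp: Basis_vec_def inner_axis)

text \<open>
  The time-one flow of the Hamiltonian \<open>a * z\<close>.
\<close>

lemma rotation_ham_step:
  "(vector [x, y, z], vector [cos a * x - sin a * y, sin a * x + cos a * y, z]) \<in> ham_step pi_sl2"
proof -
  define \<gamma> :: "real \<Rightarrow> real^3" where
    "\<gamma> t = vector [cos (a * t) * x - sin (a * t) * y, sin (a * t) * x + cos (a * t) * y, z]" for t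
  have "(\<gamma> has_vector_derivative pi_sl2 (\<gamma> t) *v vector [0, 0, a]) (at t)" for t
    unfolding has_vector_derivative_componentwise_cart \<gamma>_def pi_sl2_mult_vec forall_3
      has_real_derivative_iff_has_vector_derivative[symmetric] vector_3
    by (auto intro!: derivative_eq_intros simp: algebra_simps)
  from ham_step_linear[OF this] show ?thesis by (simp add: \<gamma>_def)
qed

text \<open>
  The time-one flow of the Hamiltonian \<open>a * x\<close>.
\<close>

lemma boost_ham_step:
  "(vector [x, y, z], vector [x, cosh a * y + sinh a * z, sinh a * y + cosh a * z]) \<in> ham_step pi_sl2"
proof -
  define \<gamma> :: "real \<Rightarrow> real^3" where
    "\<gamma> t = vector [x, cosh (a * t) * y + sinh (a * t) * z, sinh (a * t) * y + cosh (a * t) * z]" for t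
  have "(\<gamma> has_vector_derivative pi_sl2 (\<gamma> t) *v vector [a, 0, 0]) (at t)" for t
    unfolding has_vector_derivative_componentwise_cart \<gamma>_def pi_sl2_mult_vec forall_3
      has_real_derivative_iff_has_vector_derivative[symmetric] vector_3
    by (auto intro!: derivative_eq_intros simp: algebra_simps)
  from ham_step_linear[OF this] show ?thesis by (simp add: \<gamma>_def)
qed

text \<open>
  Straight lines that meet the leaves of \<open>U_plus\<close> and \<open>U_minus\<close>, respectively, in exactly one point
  each: since \<open>f = (y + z) * (y - z)\<close> on the plane \<open>x = 0\<close>, it equals \<open>c\<close> when one factor is \<open>1\<close>
  and the other is \<open>c\<close>.  That \<open>z\<close> has the wrong sign for \<open>c > 1\<close> does no harm, because a leaf
  with \<open>c > 0\<close> extends to both sides of \<open>z = 0\<close>.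
\<close>

definition section_plus :: "real \<Rightarrow> real^3" where
  "section_plus c = vector [0, (1 + c) / 2, (1 - c) / 2]"

definition section_minus :: "real \<Rightarrow> real^3" where
  "section_minus c = vector [0, (1 + c) / 2, (c - 1) / 2]"

lemma rotate_to_half_plane:
  obtains r where "r \<ge> 0" and "(p, vector [0, r, p$3]) \<in> ham_step pi_sl2"
    and "f_sl2 p = (r + p$3) * (r - p$3)"
proof -
  obtain s b where s: "p$2 = s * cos b" "p$1 = s * sin b" using polar_Ex by blast
  \<comment> \<open>Half a turn more makes the polar radius non-negative.\<close>
  define r a where "r = \<bar>s\<bar>" and "a = (if s \<ge> 0 then b else b + pi)"
  have eq: "p$2 = r * cos a" "p$1 = r * sin a" using s by (auto simp: r_def a_def)
  have sc: "r * (cos a * cos a) + r * (sin a * sin a) = r"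
    by (metis cos_squared_eq diff_add_cancel distrib_left mult.right_neutral power2_eq_square)
  have "p = vector [p$1, p$2, p$3]" by (simp add: vec_eq_iff forall_3)
  moreover have "(vector [p$1, p$2, p$3], vector [0, r, p$3]) \<in> ham_step pi_sl2"
    using rotation_ham_step[of "p$1" "p$2" "p$3" a] sc by (simp add: eq algebra_simps)
  moreover have "f_sl2 p = r * (r * (cos a * cos a) + r * (sin a * sin a)) - (p$3)\<^sup>2"
    by (simp add: f_sl2_def eq power2_eq_square algebra_simps)
  ultimately show ?thesis using that[of r] unfolding sc by (simp add: r_def power2_eq_square algebra_simps)
qed

text \<open>
  A rotation brings \<open>p\<close> to a point \<open>(0, r, z)\<close> with \<open>r \<ge> 0\<close>.  A boost multiplies \<open>r + z\<close> and
  \<open>r - z\<close> by reciprocal positive factors; the hypothesis makes \<open>r + z\<close> positive, so that it can be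
  scaled to \<open>1\<close>.
\<close>

lemma leaf_rel_section_plus:
  assumes "f_sl2 p > 0 \<or> p$3 > 0"
  shows "(p, section_plus (f_sl2 p)) \<in> leaf_rel pi_sl2"
proof -
  obtain r where r: "r \<ge> 0" and rot: "(p, vector [0, r, p$3]) \<in> ham_step pi_sl2"
    and f: "f_sl2 p = (r + p$3) * (r - p$3)"
    by (rule rotate_to_half_plane)
  have pos: "r + p$3 > 0" using assms r f by (auto simp: zero_less_mult_iff)
  define a where "a = - ln (r + p$3)"
  have e: "exp a = 1 / (r + p$3)" "exp (- a) = r + p$3"
    using pos by (simp_all add: a_def exp_minus divide_inverse)
  have "cosh a * r + sinh a * p$3 = (exp a * (r + p$3) + exp (- a) * (r - p$3)) / 2"
    "sinh a * r + cosh a * p$3 = (exp a * (r + p$3) - exp (- a) * (r - p$3)) / 2"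
    by (simp_all add: cosh_def sinh_def field_simps)
  then have "cosh a * r + sinh a * p$3 = (1 + f_sl2 p) / 2"
    "sinh a * r + cosh a * p$3 = (1 - f_sl2 p) / 2"
    using pos by (simp_all add: e f mult.commute)
  then have "(vector [0, r, p$3], section_plus (f_sl2 p)) \<in> ham_step pi_sl2"
    using boost_ham_step[of 0 r "p$3" a] unfolding section_plus_def by (simp only:)
  with rot show ?thesis unfolding leaf_rel_def by (meson rtrancl.simps)
qed

text \<open>
  The mirror image of \<open>leaf_rel_section_plus\<close>: here \<open>r - z\<close> is positive and is scaled to \<open>1\<close>.
\<close>

lemma leaf_rel_section_minus:
  assumes "f_sl2 p > 0 \<or> p$3 < 0"
  shows "(p, section_minus (f_sl2 p)) \<in> leaf_rel pi_sl2"
proof -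
  obtain r where r: "r \<ge> 0" and rot: "(p, vector [0, r, p$3]) \<in> ham_step pi_sl2"
    and f: "f_sl2 p = (r + p$3) * (r - p$3)"
    by (rule rotate_to_half_plane)
  have pos: "r - p$3 > 0" using assms r f by (auto simp: zero_less_mult_iff)
  define a where "a = ln (r - p$3)"
  have e: "exp a = r - p$3" "exp (- a) = 1 / (r - p$3)"
    using pos by (simp_all add: a_def exp_minus divide_inverse)
  have "cosh a * r + sinh a * p$3 = (exp a * (r + p$3) + exp (- a) * (r - p$3)) / 2"
    "sinh a * r + cosh a * p$3 = (exp a * (r + p$3) - exp (- a) * (r - p$3)) / 2"
    by (simp_all add: cosh_def sinh_def field_simps)
  then have "cosh a * r + sinh a * p$3 = (1 + f_sl2 p) / 2"
    "sinh a * r + cosh a * p$3 = (f_sl2 p - 1) / 2"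
    using pos by (simp_all add: e f mult.commute)
  then have "(vector [0, r, p$3], section_minus (f_sl2 p)) \<in> ham_step pi_sl2"
    using boost_ham_step[of 0 r "p$3" a] unfolding section_minus_def by (simp only:)
  with rot show ?thesis unfolding leaf_rel_def by (meson rtrancl.simps)
qed

text \<open>
  Two points with equal invariants either are both the origin or are joined to the same point of one
  of the two sections.  In the converse direction, \<open>f\<close> is a Casimir function and \<open>leaf_rel_sgn\<close>
  treats the sign.
\<close>

lemma leaf_rel_pi_sl2_iff:
  "(p, q) \<in> leaf_rel pi_sl2 \<longleftrightarrow>
     f_sl2 p = f_sl2 q \<and> (f_sl2 p \<le> 0 \<longrightarrow> sgn (p$3) = sgn (q$3))"
proof
  assume pq: "(p, q) \<in> leaf_rel pi_sl2"
  have "f_sl2 p = f_sl2 q"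
    using has_derivative_f_sl2
    by (intro casimir_constant_on_leaves[OF transpose_pi_sl2 _ schouten_f_sl2 pq])
       (rule differentiableI)
  then show "f_sl2 p = f_sl2 q \<and> (f_sl2 p \<le> 0 \<longrightarrow> sgn (p$3) = sgn (q$3))"
    using leaf_rel_sgn[OF pq] by simp
next
  assume *: "f_sl2 p = f_sl2 q \<and> (f_sl2 p \<le> 0 \<longrightarrow> sgn (p$3) = sgn (q$3))"
  have join: "(p, q) \<in> leaf_rel pi_sl2"
    if "(p, r) \<in> leaf_rel pi_sl2" "(q, r) \<in> leaf_rel pi_sl2" for r
    using that equiv_leaf_rel[of pi_sl2] by (meson equivE symE transE)
  consider "f_sl2 p > 0 \<or> p$3 > 0" | "f_sl2 p \<le> 0" "p$3 < 0" | "f_sl2 p \<le> 0" "p$3 = 0" by linarith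
  then show "(p, q) \<in> leaf_rel pi_sl2"
  proof cases
    case 1
    then have "f_sl2 q > 0 \<or> q$3 > 0" using * by (auto simp: sgn_if not_le split: if_splits)
    then show ?thesis using join leaf_rel_section_plus[of p] leaf_rel_section_plus[of q] 1 * by simp
  next
    case 2
    then have "q$3 < 0" using * by (auto simp: sgn_if split: if_splits)
    then show ?thesis using join leaf_rel_section_minus[of p] leaf_rel_section_minus[of q] 2 * by simp
  next
    case 3
    then have "p = 0" "q = 0" using * by (auto intro!: f_sl2_le_0_imp_eq_0 simp: sgn_if split: if_splits)
    then show ?thesis by (simp add: leaf_rel_def)
  qed
qed

section \<open>The regular leaf space and its charts\<close>

text \<open>
  The inverses of the two charts: the leaf of \<open>U_plus\<close>, respectively \<open>U_minus\<close>, on which \<open>f\<close>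
  takes the value \<open>c\<close>.
\<close>

definition plus_leaf :: "real \<Rightarrow> (real^3) set" where
  "plus_leaf c = (if c > 0 then S_level c else S_plus c)"

definition minus_leaf :: "real \<Rightarrow> (real^3) set" where
  "minus_leaf c = (if c > 0 then S_level c else S_minus c)"

lemma U_plus_eq: "U_plus = range plus_leaf"
proof
  show "U_plus \<subseteq> range plus_leaf"
    unfolding U_plus_def
  proof safe
    fix c :: real
    show "S_plus c \<in> range plus_leaf" if "c \<le> 0"
      using that by (intro range_eqI[of _ _ c]) (simp add: plus_leaf_def)
    show "S_level c \<in> range plus_leaf" if "c > 0"
      using that by (intro range_eqI[of _ _ c]) (simp add: plus_leaf_def)
  qed
qed (auto simp: U_plus_def plus_leaf_def not_less)

lemma U_minus_eq: "U_minus = range minus_leaf"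
proof
  show "U_minus \<subseteq> range minus_leaf"
    unfolding U_minus_def
  proof safe
    fix c :: real
    show "S_minus c \<in> range minus_leaf" if "c \<le> 0"
      using that by (intro range_eqI[of _ _ c]) (simp add: minus_leaf_def)
    show "S_level c \<in> range minus_leaf" if "c > 0"
      using that by (intro range_eqI[of _ _ c]) (simp add: minus_leaf_def)
  qed
qed (auto simp: U_minus_def minus_leaf_def not_less)

lemma f_sl2_section [simp]: "f_sl2 (section_plus c) = c" "f_sl2 (section_minus c) = c"
  by (simp_all add: f_sl2_def section_plus_def section_minus_def power2_eq_square field_simps)

lemma section_in_leaf: "section_plus c \<in> plus_leaf c" "section_minus c \<in> minus_leaf c"
  by (auto simp: plus_leaf_def minus_leaf_def S_level_def S_plus_def S_minus_def)
     (simp_all add: section_plus_def section_minus_def)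

lemma f_sl2_on_leaf: "p \<in> plus_leaf c \<Longrightarrow> f_sl2 p = c" "p \<in> minus_leaf c \<Longrightarrow> f_sl2 p = c"
  by (auto simp: plus_leaf_def minus_leaf_def S_level_def S_plus_def S_minus_def split: if_splits)

lemma leaf_value_plus_leaf [simp]: "leaf_value (plus_leaf c) = c"
proof -
  have "f_sl2 ` plus_leaf c = {c}"
    using section_in_leaf(1)[of c] by (auto simp: f_sl2_on_leaf image_iff intro!: bexI[of _ "section_plus c"])
  then show ?thesis by (auto simp: leaf_value_def)
qed

lemma leaf_value_minus_leaf [simp]: "leaf_value (minus_leaf c) = c"
proof -
  have "f_sl2 ` minus_leaf c = {c}"
    using section_in_leaf(2)[of c] by (auto simp: f_sl2_on_leaf image_iff intro!: bexI[of _ "section_minus c"])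
  then show ?thesis by (auto simp: leaf_value_def)
qed

lemma inv_into_chart_plus: "inv_into U_plus chart_plus c = plus_leaf c"
  by (rule inv_into_f_eq) (auto simp: inj_on_def chart_plus_def U_plus_eq)

lemma inv_into_chart_minus: "inv_into U_minus chart_minus c = minus_leaf c"
  by (rule inv_into_f_eq) (auto simp: inj_on_def chart_minus_def U_minus_eq)

lemma chart_reps_eq: "chart_reps F = (\<lambda>c. F (plus_leaf c), \<lambda>c. F (minus_leaf c))"
  by (simp add: chart_reps_def o_def inv_into_chart_plus inv_into_chart_minus)

lemma leaf_of_point:
  "leaf_rel pi_sl2 `` {p} =
    (if f_sl2 p > 0 \<or> p$3 > 0 then plus_leaf (f_sl2 p)
     else if p$3 < 0 then minus_leaf (f_sl2 p) else {0})"
proof -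
  have leaf: "leaf_rel pi_sl2 `` {p} =
      {q. f_sl2 q = f_sl2 p \<and> (f_sl2 p \<le> 0 \<longrightarrow> sgn (q$3) = sgn (p$3))}"
    unfolding leaf_rel_pi_sl2_iff Image_singleton Collect_mono_iff by metis
  consider "f_sl2 p > 0" | "f_sl2 p \<le> 0" "p$3 > 0" | "f_sl2 p \<le> 0" "p$3 < 0"
    | "f_sl2 p \<le> 0" "p$3 = 0" by linarith
  then show ?thesis
  proof cases
    case 1
    then show ?thesis unfolding leaf by (simp add: plus_leaf_def S_level_def)
  next
    case 2
    then show ?thesis unfolding leaf by (simp add: plus_leaf_def S_plus_def sgn_1_pos)
  next
    case 3
    then show ?thesis unfolding leaf by (simp add: minus_leaf_def S_minus_def sgn_1_neg)
  next
    case 4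
    then have "p = 0" by (rule f_sl2_le_0_imp_eq_0)
    moreover have "q = 0" if "f_sl2 q = 0" "q$3 = 0" for q
      using f_sl2_le_0_imp_eq_0[of q] that by simp
    ultimately show ?thesis unfolding leaf by (auto simp: f_sl2_def sgn_0_0)
  qed
qed

lemma leaf_nonzero: "plus_leaf c \<noteq> {0}" "minus_leaf c \<noteq> {0}"
proof -
  have "section_plus c $ 2 + section_plus c $ 3 = 1" "section_minus c $ 2 - section_minus c $ 3 = 1"
    by (simp_all add: section_plus_def section_minus_def field_simps)
  then have "section_plus c \<noteq> 0" "section_minus c \<noteq> 0"
    by (metis add_0 zero_index zero_neq_one, metis diff_0_right zero_index zero_neq_one)
  then show "plus_leaf c \<noteq> {0}" "minus_leaf c \<noteq> {0}"
    using section_in_leaf[of c] by (metis singletonD)+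
qed

lemma leaves_reg_eq: "leaves_reg = U_plus \<union> U_minus"
proof (intro equalityI subsetI)
  fix L assume "L \<in> leaves_reg"
  then have "L \<in> UNIV // leaf_rel pi_sl2" "L \<noteq> {0}"
    by (simp_all add: leaves_reg_def leaf_space_def)
  then obtain p where "L = leaf_rel pi_sl2 `` {p}" "L \<noteq> {0}"
    by (blast elim: quotientE)
  then show "L \<in> U_plus \<union> U_minus"
    by (auto simp: leaf_of_point U_plus_eq U_minus_eq split: if_splits)
next
  fix L assume "L \<in> U_plus \<union> U_minus"
  then obtain c where L: "L = plus_leaf c \<or> L = minus_leaf c"
    by (auto simp: U_plus_eq U_minus_eq)
  have "section_plus c $ 3 > 0 \<or> c > 0" "section_minus c $ 3 < 0 \<or> c > 0"
    by (auto simp: section_plus_def section_minus_def)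
  moreover have "plus_leaf c = minus_leaf c" if "c > 0"
    using that by (simp add: plus_leaf_def minus_leaf_def)
  ultimately have "leaf_rel pi_sl2 `` {section_plus c} = plus_leaf c"
      "leaf_rel pi_sl2 `` {section_minus c} = minus_leaf c"
    by (auto simp: leaf_of_point)
  then have "L \<in> leaf_space pi_sl2"
    unfolding leaf_space_def using L by (metis UNIV_I quotientI)
  then show "L \<in> leaves_reg"
    using L leaf_nonzero by (auto simp: leaves_reg_def)
qed

lemma leaf_in_leaves_reg [simp]: "plus_leaf c \<in> leaves_reg" "minus_leaf c \<in> leaves_reg"
  by (auto simp: leaves_reg_eq U_plus_eq U_minus_eq)

text \<open>
  The compatibility condition on \<open>(0, \<infinity>)\<close> is automatic, since there the two charts parametrise the
  same leaves.
\<close>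

lemma smooth_on_leaves_reg_iff:
  "F \<in> smooth_on_leaves_reg \<longleftrightarrow> F \<in> extensional leaves_reg \<and> chart_reps F \<in> smooth_pairs"
  by (auto simp: smooth_on_leaves_reg_def smooth_pairs_def chart_reps_eq plus_leaf_def minus_leaf_def)

text \<open>
  Injectivity holds because the two charts cover the regular leaf space.  For surjectivity, \<open>h1\<close> and
  \<open>h2\<close> are transported to the leaves; on the overlap of the charts both give the same value.
\<close>

lemma bij_chart_reps: "bij_betw chart_reps smooth_on_leaves_reg smooth_pairs"
  unfolding bij_betw_def
proof
  show "inj_on chart_reps smooth_on_leaves_reg"
  proof (rule inj_onI)
    fix F G
    assume F: "F \<in> smooth_on_leaves_reg" and G: "G \<in> smooth_on_leaves_reg"
      and eq: "chart_reps F = chart_reps G"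
    show "F = G"
    proof (rule extensionalityI)
      fix L assume "L \<in> leaves_reg"
      then obtain c where "L = plus_leaf c \<or> L = minus_leaf c"
        by (auto simp: leaves_reg_eq U_plus_eq U_minus_eq)
      then show "F L = G L"
        using eq by (auto simp: chart_reps_eq fun_eq_iff)
    qed (use F G in \<open>simp_all add: smooth_on_leaves_reg_iff\<close>)
  qed
next
  have "h \<in> chart_reps ` smooth_on_leaves_reg" if "h \<in> smooth_pairs" for h
  proof -
    define F where "F = (\<lambda>L\<in>leaves_reg.
      if L \<in> U_plus then fst h (leaf_value L) else snd h (leaf_value L))"
    have "F (minus_leaf c) = snd h c" for c
    proof (cases "minus_leaf c \<in> U_plus")
      case True
      then obtain d where d: "minus_leaf c = plus_leaf d" by (auto simp: U_plus_eq)
      then have "d = c" by (metis leaf_value_minus_leaf leaf_value_plus_leaf)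
      then have "section_minus c \<in> plus_leaf c" using d section_in_leaf(2)[of c] by simp
      then have "c > 0"
        by (auto simp: plus_leaf_def S_plus_def section_minus_def split: if_splits)
      then show ?thesis using that by (auto simp: F_def smooth_pairs_def)
    qed (simp add: F_def)
    then have "chart_reps F = h"
      by (simp add: chart_reps_eq) (simp add: F_def U_plus_eq)
    moreover from this have "F \<in> smooth_on_leaves_reg"
      using that by (simp add: smooth_on_leaves_reg_iff F_def)
    ultimately show ?thesis by (metis imageI)
  qed
  then show "chart_reps ` smooth_on_leaves_reg = smooth_pairs"
    by (auto simp: smooth_on_leaves_reg_iff)
qed

section \<open>Casimir functions as pairs of functions of \<open>f\<close>\<close>

text \<open>
  The gradient of \<open>tilde h\<close> is a multiple of the gradient of \<open>f\<close>, which \<open>pi_sl2\<close> annihilates.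
\<close>

lemma tilde_in_casimirs:
  assumes "h \<in> smooth_pairs"
  shows "tilde h \<in> casimirs pi_sl2"
proof -
  obtain h1 h2 where h: "h = (h1, h2)" by (cases h)
  have "gradient (tilde h) p = tilde (deriv h1, deriv h2) p *\<^sub>R vector [2 * p$1, 2 * p$2, - 2 * p$3]" for p
    using has_derivative_tilde[of h1 h2 p] assms h by (intro gradient_eqI) simp
  then have "schouten pi_sl2 (tilde h) p = 0" for p
    by (simp add: schouten_def pi_sl2_mult_vec vec_eq_iff forall_3 algebra_simps)
  then show ?thesis
    using Ck_tilde assms h by (simp add: casimirs_def smooth_def)
qed

lemma smooth_section: "smooth g \<Longrightarrow> smooth (\<lambda>c. g (section_plus c))"
  "smooth g \<Longrightarrow> smooth (\<lambda>c. g (section_minus c))"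
proof -
  have eq: "section_plus c = c *\<^sub>R vector [0, 1/2, - 1/2] + vector [0, 1/2, 1/2]"
    "section_minus c = c *\<^sub>R vector [0, 1/2, 1/2] + vector [0, 1/2, - 1/2]" for c
    by (simp_all add: section_plus_def section_minus_def vec_eq_iff forall_3 field_simps)
  assume "smooth g"
  then show "smooth (\<lambda>c. g (section_plus c))" "smooth (\<lambda>c. g (section_minus c))"
    unfolding eq by (auto intro: smooth_compose_affine bounded_linear_scaleR_left)
qed

text \<open>
  Hence \<open>h\<close> can be recovered from \<open>tilde h\<close> by restriction to the two sections.
\<close>

lemma tilde_section:
  assumes "h \<in> smooth_pairs"
  shows "tilde h (section_plus c) = fst h c" "tilde h (section_minus c) = snd h c"
proof -
  have "section_plus c $ 3 \<ge> 0 \<or> c > 0" "section_minus c $ 3 < 0 \<or> c > 0"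
    by (auto simp: section_plus_def section_minus_def)
  then show "tilde h (section_plus c) = fst h c" "tilde h (section_minus c) = snd h c"
    using assms by (auto simp: tilde_def smooth_pairs_def)
qed

text \<open>
  A Casimir function is constant on leaves, hence is determined away from the origin by its values
  on the two sections.  The origin is a leaf that meets neither section, but it lies in the closure
  of a leaf that does.
\<close>

lemma casimir_eq_tilde:
  assumes g: "g \<in> casimirs pi_sl2"
  shows "(\<lambda>c. g (section_plus c), \<lambda>c. g (section_minus c)) \<in> smooth_pairs" (is "?h \<in> _")
    and "tilde (\<lambda>c. g (section_plus c), \<lambda>c. g (section_minus c)) = g"
proof -
  have s: "smooth g" using g by (simp add: casimirs_def)
  have const: "g p = g q" if "(p, q) \<in> leaf_rel pi_sl2" for p q
    using that g by (intro casimir_constant_on_leaves[OF transpose_pi_sl2])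
      (auto simp: casimirs_def intro: smooth_differentiable)
  have "g (section_plus t) = g (section_minus t)" if "t > 0" for t
    using that by (intro const) (simp add: leaf_rel_pi_sl2_iff)
  then show "?h \<in> smooth_pairs"
    by (simp add: smooth_pairs_def smooth_section s)
  \<comment> \<open>The ray through \<open>section_plus 0\<close> lies in one leaf apart from its end point \<open>0\<close>.\<close>
  have at_0: "g 0 = g (section_plus 0)"
  proof -
    define \<rho> where "\<rho> \<epsilon> = g (\<epsilon> *\<^sub>R section_plus 0)" for \<epsilon> :: real
    have "continuous_on (closure {0<..}) \<rho>"
      unfolding \<rho>_def
      by (intro continuous_on_compose2[OF smooth_continuous[OF s, of UNIV]] continuous_intros) auto
    moreover have "\<rho> \<epsilon> = g (section_plus 0)" if "\<epsilon> \<in> {0<..}" for \<epsilon>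
      unfolding \<rho>_def using that
      by (intro const) (simp add: leaf_rel_pi_sl2_iff section_plus_def f_sl2_def sgn_mult)
    ultimately have "\<rho> 0 = g (section_plus 0)"
      by (rule continuous_constant_on_closure) auto
    then show ?thesis by (simp add: \<rho>_def)
  qed
  show "tilde ?h = g"
  proof
    fix p
    consider "p$3 < 0" | "p$3 \<ge> 0" "f_sl2 p > 0 \<or> p$3 > 0" | "p$3 = 0" "f_sl2 p \<le> 0" by linarith
    then show "tilde ?h p = g p"
    proof cases
      case 1
      then show ?thesis using const[OF leaf_rel_section_minus[of p]] by (simp add: tilde_def)
    next
      case 2
      then show ?thesis using const[OF leaf_rel_section_plus[of p]] by (simp add: tilde_def)
    next
      case 3
      then have "p = 0" by (intro f_sl2_le_0_imp_eq_0)
      then show ?thesis using at_0 by (simp add: tilde_def f_sl2_def)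
    qed
  qed
qed

lemma bij_tilde: "bij_betw tilde smooth_pairs (casimirs pi_sl2)"
proof (rule bij_betw_byWitness)
  show "\<forall>h\<in>smooth_pairs. (\<lambda>g. (\<lambda>c. g (section_plus c), \<lambda>c. g (section_minus c))) (tilde h) = h"
    by (simp add: tilde_section)
  show "\<forall>g\<in>casimirs pi_sl2. tilde ((\<lambda>g. (\<lambda>c. g (section_plus c), \<lambda>c. g (section_minus c))) g) = g"
    by (simp add: casimir_eq_tilde(2))
qed (auto simp: tilde_in_casimirs casimir_eq_tilde(1))

section \<open>The algebra isomorphisms\<close>

lemma cring_real_ring: "cring real_ring"
proof (intro cringI abelian_groupI comm_monoidI)
  show "\<exists>y\<in>carrier real_ring. y \<oplus>\<^bsub>real_ring\<^esub> x = \<zero>\<^bsub>real_ring\<^esub>" if "x \<in> carrier real_ring" for x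
    by (auto simp: real_ring_def intro: exI[of _ "- x"])
qed (auto simp: real_ring_def algebra_simps)

lemma algebra_fun_algebra:
  assumes ext: "A \<subseteq> extensional X"
    and const: "\<And>c. (\<lambda>x\<in>X. c) \<in> A"
    and add: "\<And>g h. g \<in> A \<Longrightarrow> h \<in> A \<Longrightarrow> (\<lambda>x\<in>X. g x + h x) \<in> A"
    and mult: "\<And>g h. g \<in> A \<Longrightarrow> h \<in> A \<Longrightarrow> (\<lambda>x\<in>X. g x * h x) \<in> A"
  shows "Module.algebra real_ring (fun_algebra X A)"
proof -
  have smult: "(\<lambda>x\<in>X. c * g x) \<in> A" if "g \<in> A" for c g
  proof -
    have "(\<lambda>x\<in>X. (\<lambda>x\<in>X. c) x * g x) \<in> A" by (intro mult const that)
    then show ?thesis by (simp cong: restrict_cong)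
  qed
  have id: "restrict g X = g" if "g \<in> A" for g
    using that ext by (auto intro: extensional_restrict)
  note simps = fun_algebra_def id algebra_simps
  show ?thesis
  proof (intro algebraI cring_real_ring cringI abelian_groupI comm_monoidI)
    fix g assume g: "g \<in> carrier (fun_algebra X A)"
    show "\<exists>h\<in>carrier (fun_algebra X A). h \<oplus>\<^bsub>fun_algebra X A\<^esub> g = \<zero>\<^bsub>fun_algebra X A\<^esub>"
      using smult[of g "-1"] g
      by (intro bexI[of _ "\<lambda>x\<in>X. -1 * g x"]) (simp_all add: fun_algebra_def cong: restrict_cong)
  qed (simp_all add: simps real_ring_def const add mult smult cong: restrict_cong)
qed

lemma smooth_pairs_closed:
  shows "(\<lambda>t. c, \<lambda>t. c) \<in> smooth_pairs"
    and "(g1, g2) \<in> smooth_pairs \<Longrightarrow> (h1, h2) \<in> smooth_pairs \<Longrightarrow>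
      (\<lambda>t. g1 t + h1 t, \<lambda>t. g2 t + h2 t) \<in> smooth_pairs"
    and "(g1, g2) \<in> smooth_pairs \<Longrightarrow> (h1, h2) \<in> smooth_pairs \<Longrightarrow>
      (\<lambda>t. g1 t * h1 t, \<lambda>t. g2 t * h2 t) \<in> smooth_pairs"
    and "(h1, h2) \<in> smooth_pairs \<Longrightarrow> (\<lambda>t. c * h1 t, \<lambda>t. c * h2 t) \<in> smooth_pairs"
  by (auto simp: smooth_pairs_def intro: smooth_const smooth_add smooth_mult)

lemma algebra_pair_algebra: "Module.algebra real_ring pair_algebra"
proof (intro algebraI cring_real_ring cringI abelian_groupI comm_monoidI)
  fix h assume "h \<in> carrier pair_algebra"
  then show "\<exists>k\<in>carrier pair_algebra. k \<oplus>\<^bsub>pair_algebra\<^esub> h = \<zero>\<^bsub>pair_algebra\<^esub>"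
    using smooth_pairs_closed(4)[of "fst h" "snd h" "-1"]
    by (intro bexI[of _ "(\<lambda>t. -1 * fst h t, \<lambda>t. -1 * snd h t)"])
       (auto simp: pair_algebra_def split: prod.splits)
qed (auto simp: pair_algebra_def real_ring_def smooth_pairs_closed algebra_simps)

lemma algebra_leaf_algebra: "Module.algebra real_ring leaf_algebra"
  unfolding leaf_algebra_def
  by (rule algebra_fun_algebra)
     (auto simp: smooth_on_leaves_reg_iff chart_reps_eq smooth_pairs_closed)

text \<open>
  That Casimir functions form an algebra is read off from pairs, as \<open>tilde\<close> is pointwise in \<open>h\<close> and
  maps onto the Casimir functions.
\<close>

lemma algebra_cas_algebra: "Module.algebra real_ring cas_algebra"
  unfolding cas_algebra_def
proof (rule algebra_fun_algebra)
  have im: "casimirs pi_sl2 = tilde ` smooth_pairs"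
    using bij_tilde by (simp add: bij_betw_def)
  show "(\<lambda>x\<in>UNIV. c) \<in> casimirs pi_sl2" for c
  proof -
    have "(\<lambda>x\<in>UNIV. c) = tilde (\<lambda>t. c, \<lambda>t. c)" by (auto simp: tilde_def)
    then show ?thesis by (simp add: tilde_in_casimirs smooth_pairs_closed(1))
  qed
  fix g h assume "g \<in> casimirs pi_sl2" "h \<in> casimirs pi_sl2"
  then obtain g1 g2 h1 h2 where gh: "(g1, g2) \<in> smooth_pairs" "(h1, h2) \<in> smooth_pairs"
    and eq: "g = tilde (g1, g2)" "h = tilde (h1, h2)"
    unfolding im by auto
  have "(\<lambda>x\<in>UNIV. g x + h x) = tilde (\<lambda>t. g1 t + h1 t, \<lambda>t. g2 t + h2 t)"
    "(\<lambda>x\<in>UNIV. g x * h x) = tilde (\<lambda>t. g1 t * h1 t, \<lambda>t. g2 t * h2 t)"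
    by (auto simp: eq tilde_def)
  then show "(\<lambda>x\<in>UNIV. g x + h x) \<in> casimirs pi_sl2" "(\<lambda>x\<in>UNIV. g x * h x) \<in> casimirs pi_sl2"
    using smooth_pairs_closed(2,3)[OF gh] by (simp_all add: tilde_in_casimirs)
qed simp

lemma chart_reps_iso: "chart_reps \<in> algebra_iso real_ring leaf_algebra pair_algebra"
  unfolding algebra_iso_def
proof (intro CollectI conjI ring_iso_memI ballI)
  show "bij_betw chart_reps (carrier leaf_algebra) (carrier pair_algebra)"
    using bij_chart_reps by (simp add: leaf_algebra_def fun_algebra_def pair_algebra_def)
qed (auto simp: leaf_algebra_def fun_algebra_def pair_algebra_def chart_reps_eq
       smooth_on_leaves_reg_iff)

lemma tilde_iso: "tilde \<in> algebra_iso real_ring pair_algebra cas_algebra"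
  unfolding algebra_iso_def
proof (intro CollectI conjI ring_iso_memI ballI)
  show "bij_betw tilde (carrier pair_algebra) (carrier cas_algebra)"
    using bij_tilde by (simp add: cas_algebra_def fun_algebra_def pair_algebra_def)
qed (auto simp: cas_algebra_def fun_algebra_def pair_algebra_def tilde_in_casimirs tilde_def
       split: prod.splits)

lemma algebra_iso_comp:
  assumes "\<phi> \<in> algebra_iso R A B" and "\<psi> \<in> algebra_iso R B C"
  shows "\<psi> \<circ> \<phi> \<in> algebra_iso R A C"
  using assms ring_iso_set_trans[of \<phi> A B \<psi> C] ring_iso_memE(1)[of \<phi> A B]
  by (auto simp: algebra_iso_def)

theorem proposition2p1:
  shows "Module.algebra real_ring leaf_algebra
       \<and> Module.algebra real_ring pair_algebra
       \<and> Module.algebra real_ring cas_algebra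
       \<and> chart_reps \<in> algebra_iso real_ring leaf_algebra pair_algebra
       \<and> tilde \<in> algebra_iso real_ring pair_algebra cas_algebra
       \<and> tilde \<circ> chart_reps \<in> algebra_iso real_ring leaf_algebra cas_algebra"
  using algebra_leaf_algebra algebra_pair_algebra algebra_cas_algebra chart_reps_iso tilde_iso
    algebra_iso_comp[OF chart_reps_iso tilde_iso] by blast

end
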